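(* The multi-channel network activity process $\{X_C(t)\}_{t\ge 0}$ has product-form stationary distribution $$\pi_C(x)=Z^{-1}\prod_{i=1}^N\prod_{c=1}^{C}\left(\frac{\nu_{i,c}}{\mu_{i,c}}\right)^{\mathbf 1_{\{x_i=c\}}},\qquad x\in\mathcal X_C,$$ where $Z=\sum_{x\in\mathcal X_C}\prod_{i=1}^N\prod_{c=1}^{C}(\nu_{i,c}/\mu_{i,c})^{\mathbf 1_{\{x_i=c\}}}$ is the normalizing constant.
   Context: Let $V=\{1,\dots,N\}$ be a finite set of nodes and $C\ge 1$ the number of channels. For each $c\in\{1,\dots,C\}$ let $G_c=(V,E_c)$ be a simple undirected graph (the conflict graph on channel $c$; the graphs may differ for different $c$). Let $\nu_{i,c}>0$ and $\mu_{i,c}>0$ for $i\in V$, $1\le c\le C$. The set of feasible states is $$\mathcal X_C=\{x\in\{0,1,\dots,C\}^N:\ \text{for every } c\in\{1,\dots,C\}\text{ and every }(i,j)\in E_c,\ \text{not both } x_i=c \text{ and } x_j=c\},$$ where $x_i=0$ means node $i$ is inactive and $x_i=c\geq 1$ means node $i$ is active on channel $c$. The process $\{X_C(t)\}_{t\ge0}$ is the continuous-time Markov process on $\mathcal X_C$ with transition rates, for $x\ne y$ in $\mathcal X_C$: $q_C(x,y)=\nu_{i,c}$ if $x_i=0$ and $y=x+c\,e_i$; $q_C(x,y)=\mu_{i,c}$ if $x_i=c$ and $y=x-c\,e_i$; $q_C(x,y)=0$ otherwise (here $1\le c\le C$ and $e_i$ is the $i$-th unit vector). *)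

theory Defs
  imports "HOL-Probability.Probability"
begin

section \<open>Continuous-time Markov processes on a finite state space\<close>

text \<open>
  A process is specified by its off-diagonal transition rates \<open>q x y\<close> (\<open>x \<noteq> y\<close>) on a finite
  state space \<open>S\<close>; values \<open>q x x\<close> are ignored.  The transition function is the matrix
  exponential of \<open>t\<close> times the generator, written as its power series because square matrices
  indexed by a set do not form a Banach algebra type.
\<close>

definition generator :: "'s set \<Rightarrow> ('s \<Rightarrow> 's \<Rightarrow> real) \<Rightarrow> 's \<Rightarrow> 's \<Rightarrow> real" where
  "generator S q x y = (if x = y then - (\<Sum>z\<in>S - {x}. q x z) else q x y)"

primrec generator_power :: "'s set \<Rightarrow> ('s \<Rightarrow> 's \<Rightarrow> real) \<Rightarrow> nat \<Rightarrow> 's \<Rightarrow> 's \<Rightarrow> real" where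
  "generator_power S q 0 = (\<lambda>x y. if x = y then 1 else 0)"
| "generator_power S q (Suc n) =
     (\<lambda>x y. \<Sum>z\<in>S. generator S q x z * generator_power S q n z y)"

definition transition_prob :: "'s set \<Rightarrow> ('s \<Rightarrow> 's \<Rightarrow> real) \<Rightarrow> real \<Rightarrow> 's \<Rightarrow> 's \<Rightarrow> real" where
  "transition_prob S q t x y = (\<Sum>n. t ^ n / fact n * generator_power S q n x y)"

lemma transition_prob_summable:
  assumes "finite S" "x \<in> S"
  shows "summable (\<lambda>n. t ^ n / fact n * generator_power S q n x y)"
proof -
  define K where "K = (\<Sum>x\<in>S. \<Sum>z\<in>S. \<bar>generator S q x z\<bar>)"
  have K: "(\<Sum>z\<in>S. \<bar>generator S q x z\<bar>) \<le> K" if "x \<in> S" for x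
    unfolding K_def using assms(1) that
    by (intro member_le_sum[where f = "\<lambda>x. \<Sum>z\<in>S. \<bar>generator S q x z\<bar>"]) (auto intro: sum_nonneg)
  have K0: "0 \<le> K" unfolding K_def by (intro sum_nonneg) auto
  have bound: "\<bar>generator_power S q n x y\<bar> \<le> K ^ n" if "x \<in> S" for n x
    using that
  proof (induction n arbitrary: x)
    case (Suc n)
    have "\<bar>generator_power S q (Suc n) x y\<bar>
        \<le> (\<Sum>z\<in>S. \<bar>generator S q x z\<bar> * \<bar>generator_power S q n z y\<bar>)"
      by (auto simp: abs_mult[symmetric])
    also have "\<dots> \<le> (\<Sum>z\<in>S. \<bar>generator S q x z\<bar> * K ^ n)"
      using Suc.IH by (intro sum_mono mult_left_mono) auto
    also have "\<dots> = (\<Sum>z\<in>S. \<bar>generator S q x z\<bar>) * K ^ n" by (simp add: sum_distrib_right)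
    also have "\<dots> \<le> K * K ^ n" using K[OF Suc.prems] K0 by (intro mult_right_mono) auto
    finally show ?case by simp
  qed auto
  have "norm (t ^ n / fact n * generator_power S q n x y) \<le> inverse (fact n) * (\<bar>t\<bar> * K) ^ n" for n
    using mult_left_mono[OF bound[OF assms(2), of n], of "\<bar>t\<bar> ^ n / fact n"]
    by (simp add: abs_mult power_abs power_mult_distrib field_simps)
  then show ?thesis
    by (intro summable_comparison_test'[OF summable_exp[of "\<bar>t\<bar> * K"], of 0]) auto
qed

text \<open>
  The Markov property is expressed by the finite-dimensional distributions.
\<close>

definition markov_process ::
  "'w measure \<Rightarrow> 's set \<Rightarrow> ('s \<Rightarrow> 's \<Rightarrow> real) \<Rightarrow> (real \<Rightarrow> 'w \<Rightarrow> 's) \<Rightarrow> bool" where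
  "markov_process M S q X \<longleftrightarrow>
     prob_space M \<and>
     (\<forall>t\<ge>0. X t \<in> measurable M (count_space S)) \<and>
     (\<forall>n (t :: nat \<Rightarrow> real) x.
        0 \<le> t 0 \<and> (\<forall>k<n. t k \<le> t (Suc k)) \<and> (\<forall>k\<le>n. x k \<in> S) \<longrightarrow>
        measure M {\<omega> \<in> space M. \<forall>k\<le>n. X (t k) \<omega> = x k} =
        measure M {\<omega> \<in> space M. X (t 0) \<omega> = x 0} *
        (\<Prod>k<n. transition_prob S q (t (Suc k) - t k) (x k) (x (Suc k))))"

definition stationary_distribution :: "'s set \<Rightarrow> ('s \<Rightarrow> 's \<Rightarrow> real) \<Rightarrow> ('s \<Rightarrow> real) \<Rightarrow> bool" where
  "stationary_distribution S q p \<longleftrightarrow>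
     (\<forall>x\<in>S. 0 \<le> p x) \<and> (\<Sum>x\<in>S. p x) = 1 \<and>
     (\<forall>t\<ge>0. \<forall>y\<in>S. (\<Sum>x\<in>S. p x * transition_prob S q t x y) = p y)"


section \<open>The multi-channel network\<close>

definition simple_graph :: "'v set \<Rightarrow> ('v \<times> 'v) set \<Rightarrow> bool" where
  "simple_graph V E \<longleftrightarrow> E \<subseteq> V \<times> V \<and> sym E \<and> irrefl E"

text \<open>
  States are extensional functions on \<open>{1..N}\<close> (value \<open>undefined\<close> outside), so that the state
  space is finite and states are equal iff their components are.
\<close>

definition feasible_states :: "nat \<Rightarrow> nat \<Rightarrow> (nat \<Rightarrow> (nat \<times> nat) set) \<Rightarrow> (nat \<Rightarrow> nat) set" where
  "feasible_states N C E =
     {x \<in> {1..N} \<rightarrow>\<^sub>E {0..C}. \<forall>c\<in>{1..C}. \<forall>(i, j)\<in>E c. \<not> (x i = c \<and> x j = c)}"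

text \<open>
  At most one summand below is nonzero: \<open>x\<close> and \<open>y\<close> determine the direction of the transition,
  the node \<open>i\<close> and the channel \<open>c\<close>.
\<close>

definition transition_rate ::
  "nat \<Rightarrow> nat \<Rightarrow> (nat \<Rightarrow> nat \<Rightarrow> real) \<Rightarrow> (nat \<Rightarrow> nat \<Rightarrow> real) \<Rightarrow> (nat \<Rightarrow> nat) \<Rightarrow> (nat \<Rightarrow> nat) \<Rightarrow> real" where
  "transition_rate N C \<nu> \<mu> x y =
     (\<Sum>i\<in>{1..N}. \<Sum>c\<in>{1..C}.
        (if x i = 0 \<and> y = x(i := x i + c) then \<nu> i c else 0) +
        (if x i = c \<and> y = x(i := x i - c) then \<mu> i c else 0))"

definition state_weight ::
  "nat \<Rightarrow> nat \<Rightarrow> (nat \<Rightarrow> nat \<Rightarrow> real) \<Rightarrow> (nat \<Rightarrow> nat \<Rightarrow> real) \<Rightarrow> (nat \<Rightarrow> nat) \<Rightarrow> real" where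
  "state_weight N C \<nu> \<mu> x =
     (\<Prod>i\<in>{1..N}. \<Prod>c\<in>{1..C}. (\<nu> i c / \<mu> i c) ^ (if x i = c then 1 else 0))"

definition normalizing_constant ::
  "nat \<Rightarrow> nat \<Rightarrow> (nat \<Rightarrow> (nat \<times> nat) set) \<Rightarrow> (nat \<Rightarrow> nat \<Rightarrow> real) \<Rightarrow> (nat \<Rightarrow> nat \<Rightarrow> real) \<Rightarrow> real" where
  "normalizing_constant N C E \<nu> \<mu> = (\<Sum>x\<in>feasible_states N C E. state_weight N C \<nu> \<mu> x)"

definition product_form ::
  "nat \<Rightarrow> nat \<Rightarrow> (nat \<Rightarrow> (nat \<times> nat) set) \<Rightarrow> (nat \<Rightarrow> nat \<Rightarrow> real) \<Rightarrow> (nat \<Rightarrow> nat \<Rightarrow> real) \<Rightarrow>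
     (nat \<Rightarrow> nat) \<Rightarrow> real" where
  "product_form N C E \<nu> \<mu> x =
     inverse (normalizing_constant N C E \<nu> \<mu>) * state_weight N C \<nu> \<mu> x"

end

theory Submission imports Defs begin

text \<open>
  The weights satisfy detailed balance: activating node \<open>i\<close> on channel \<open>c\<close> multiplies the weight
  by \<open>\<nu> i c / \<mu> i c\<close>, which is the ratio of the rates of this transition and its reversal.
  Hence the product form is annihilated by the generator \<open>Q\<close>, so that in \<open>\<pi> exp (t Q)\<close> only the
  zeroth term of the power series survives.
\<close>

text \<open>The off-diagonal terms are the probability flow into \<open>y\<close>. Balance turns
  each of them into a flow out of \<open>y\<close>, and their total cancels against the diagonal
  entry, which is minus the total exit rate.\<close>

lemma detailed_balance_generator:
  assumes "finite S" "y \<in> S"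
    and balance: "\<And>x y. x \<in> S \<Longrightarrow> y \<in> S \<Longrightarrow> p x * q x y = p y * q y x"
  shows "(\<Sum>x\<in>S. p x * generator S q x y) = 0"
proof -
  have "(\<Sum>x\<in>S. p x * generator S q x y)
      = p y * generator S q y y + (\<Sum>x\<in>S - {y}. p x * generator S q x y)"
    using assms(1,2) by (rule sum.remove)
  also have "(\<Sum>x\<in>S - {y}. p x * generator S q x y) = (\<Sum>x\<in>S - {y}. p y * q y x)"
    by (intro sum.cong) (auto simp: generator_def balance assms(2))
  also have "p y * generator S q y y + \<dots> = 0"
    by (simp add: generator_def sum_distrib_left)
  finally show ?thesis .
qed

lemma stationary_distributionI:
  assumes "finite S" "\<And>x. x \<in> S \<Longrightarrow> 0 \<le> p x" "(\<Sum>x\<in>S. p x) = 1"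
    and null: "\<And>y. y \<in> S \<Longrightarrow> (\<Sum>x\<in>S. p x * generator S q x y) = 0"
  shows "stationary_distribution S q p"
  unfolding stationary_distribution_def
proof (intro conjI ballI allI impI)
  fix t :: real and y assume "y \<in> S"
  let ?g = "\<lambda>x n. t ^ n / fact n * generator_power S q n x y"
  \<comment> \<open>The recursion of \<open>generator_power\<close> puts the new generator factor on
    the left, where it meets \<open>p\<close> directly. A case distinction on \<open>n\<close>
    therefore suffices, without induction.\<close>
  have power: "(\<Sum>x\<in>S. p x * generator_power S q n x y) = (if n = 0 then p y else 0)" for n
  proof (cases n)
    case 0
    then show ?thesis using assms(1) \<open>y \<in> S\<close>
      by (simp add: if_distrib[of "(*) _"] sum.delta' cong: if_cong)
  next
    case (Suc m)
    have "(\<Sum>x\<in>S. p x * generator_power S q n x y)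
        = (\<Sum>z\<in>S. \<Sum>x\<in>S. p x * generator S q x z * generator_power S q m z y)"
      by (subst sum.swap) (simp add: Suc sum_distrib_left mult.assoc)
    also have "\<dots> = (\<Sum>z\<in>S. (\<Sum>x\<in>S. p x * generator S q x z) * generator_power S q m z y)"
      by (simp add: sum_distrib_right)
    also have "\<dots> = 0" by (simp add: null)
    finally show ?thesis using Suc by simp
  qed
  have summable: "summable (?g x)" if "x \<in> S" for x
    using transition_prob_summable[OF assms(1) that] .
  have "(\<Sum>x\<in>S. p x * transition_prob S q t x y) = (\<Sum>x\<in>S. \<Sum>n. p x * ?g x n)"
    unfolding transition_prob_def by (intro sum.cong refl suminf_mult[symmetric] summable)
  also have "\<dots> = (\<Sum>n. \<Sum>x\<in>S. p x * ?g x n)"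
    by (intro suminf_sum[symmetric] summable_mult summable)
  also have "\<dots> = (\<Sum>n. t ^ n / fact n * (\<Sum>x\<in>S. p x * generator_power S q n x y))"
    by (simp add: sum_distrib_left mult.left_commute)
  also have "\<dots> = (\<Sum>n\<in>{0}. t ^ n / fact n * (\<Sum>x\<in>S. p x * generator_power S q n x y))"
    by (rule suminf_finite) (simp_all add: power)
  \<comment> \<open>The remaining coefficient \<open>t ^ 0 / fact 0\<close> is 1, also at
    \<open>t = 0\<close>.\<close>
  also have "\<dots> = p y" by (simp only: power) simp
  finally show "(\<Sum>x\<in>S. p x * transition_prob S q t x y) = p y" .
qed (use assms in auto)

text \<open>Decomposing over the initial state links the algebraic notion of stationarity to the law
  of an actual process. Each joint probability is a two-point finite-dimensional
  distribution.\<close>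

lemma markov_process_transition:
  assumes "markov_process M S q X" "finite S" "0 \<le> t" "y \<in> S"
  shows "measure M {\<omega> \<in> space M. X t \<omega> = y} =
    (\<Sum>x\<in>S. measure M {\<omega> \<in> space M. X 0 \<omega> = x} * transition_prob S q t x y)"
proof -
  interpret prob_space M using assms(1) by (simp add: markov_process_def)
  have meas: "X s \<in> measurable M (count_space S)" if "0 \<le> s" for s
    using assms(1) that by (simp add: markov_process_def)
  let ?A = "\<lambda>x. {\<omega> \<in> space M. X 0 \<omega> = x \<and> X t \<omega> = y}"
  have sets: "{\<omega> \<in> space M. X s \<omega> = x} \<in> sets M" if "0 \<le> s" "x \<in> S" for s x
    using measurable_sets[OF meas[OF that(1)], of "{x}"] that(2)
    by (simp add: vimage_def Int_def conj_commute)
  have pair: "?A x \<in> sets M" if "x \<in> S" for x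
    using sets.Int[OF sets[of 0 x] sets[of t y]] that assms(3,4)
    by (simp add: Int_def conj_commute conj_left_commute)
  \<comment> \<open>Measurability into \<open>count_space S\<close> forces \<open>X 0\<close> to
    take its values in \<open>S\<close>, so these events cover.\<close>
  have "{\<omega> \<in> space M. X t \<omega> = y} = (\<Union>x\<in>S. ?A x)"
    using measurable_space[OF meas[of 0]] by auto
  then have "measure M {\<omega> \<in> space M. X t \<omega> = y} = (\<Sum>x\<in>S. measure M (?A x))"
    using finite_measure_finite_Union[OF assms(2), of ?A] pair
    by (auto simp: disjoint_family_on_def)
  also have "\<dots> = (\<Sum>x\<in>S. measure M {\<omega> \<in> space M. X 0 \<omega> = x} * transition_prob S q t x y)"
  proof (rule sum.cong)
    fix x assume "x \<in> S"
    \<comment> \<open>The Markov property is instantiated with \<open>n = 1\<close>: only the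
      indices 0 and 1 are inspected, and the product has a single factor.\<close>
    let ?t = "\<lambda>k::nat. if k = 0 then 0 else t" and ?x = "\<lambda>k::nat. if k = 0 then x else y"
    have "measure M {\<omega> \<in> space M. \<forall>k\<le>1. X (?t k) \<omega> = ?x k} =
        measure M {\<omega> \<in> space M. X (?t 0) \<omega> = ?x 0} *
        (\<Prod>k<1. transition_prob S q (?t (Suc k) - ?t k) (?x k) (?x (Suc k)))"
      using assms \<open>x \<in> S\<close> unfolding markov_process_def by (elim conjE allE) (erule mp, auto)
    moreover have "(\<forall>k\<le>1. X (?t k) \<omega> = ?x k) \<longleftrightarrow> X 0 \<omega> = x \<and> X t \<omega> = y" for \<omega>
      by (auto simp: le_Suc_eq)
    ultimately show "measure M (?A x) =
        measure M {\<omega> \<in> space M. X 0 \<omega> = x} * transition_prob S q t x y"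
      by simp
  qed simp
  finally show ?thesis .
qed

lemma finite_feasible_states: "finite (feasible_states N C E)"
  unfolding feasible_states_def
  by (rule finite_subset[of _ "{1..N} \<rightarrow>\<^sub>E {0..C}"]) (auto intro: finite_PiE)

text \<open>Provides a state that makes the normalizing constant positive. Edges must stay inside
  \<open>{1..N}\<close>: outside, a state takes the value \<open>undefined\<close>, which might be a
  channel number.\<close>

lemma idle_feasible: "(\<lambda>i\<in>{1..N}. 0) \<in> feasible_states N C E"
  if "\<And>c. c \<in> {1..C} \<Longrightarrow> simple_graph {1..N} (E c)"
  using that by (fastforce simp: feasible_states_def simple_graph_def)

lemma state_weight_pos:
  assumes "\<And>i c. i \<in> {1..N} \<Longrightarrow> c \<in> {1..C} \<Longrightarrow> \<nu> i c > 0"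
    and "\<And>i c. i \<in> {1..N} \<Longrightarrow> c \<in> {1..C} \<Longrightarrow> \<mu> i c > 0"
  shows "state_weight N C \<nu> \<mu> x > 0"
  unfolding state_weight_def using assms by (intro prod_pos zero_less_power divide_pos_pos) auto

text \<open>Only the factor of node \<open>i\<close> changes: it is 1 while the node is idle, and
  afterwards only channel \<open>c\<close> contributes to it.\<close>

lemma state_weight_activate:
  assumes "i \<in> {1..N}" "c \<in> {1..C}" "x i = 0"
  shows "state_weight N C \<nu> \<mu> (x(i := c)) = \<nu> i c / \<mu> i c * state_weight N C \<nu> \<mu> x"
proof -
  let ?f = "\<lambda>x j. \<Prod>d\<in>{1..C}. (\<nu> j d / \<mu> j d) ^ (if x j = d then 1 else 0)"
  have split: "state_weight N C \<nu> \<mu> z = ?f z i * (\<Prod>j\<in>{1..N} - {i}. ?f z j)" for z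
    unfolding state_weight_def using assms(1) by (intro prod.remove) auto
  have "?f (x(i := c)) i = (\<Prod>d\<in>{1..C}. if c = d then \<nu> i d / \<mu> i d else 1)"
    by (intro prod.cong) auto
  also have "\<dots> = \<nu> i c / \<mu> i c" using assms(2) by (simp add: prod.delta)
  finally have "?f (x(i := c)) i = \<nu> i c / \<mu> i c" .
  moreover have "?f x i = 1" using assms(3) by (intro prod.neutral) auto
  moreover have "(\<Prod>j\<in>{1..N} - {i}. ?f (x(i := c)) j) = (\<Prod>j\<in>{1..N} - {i}. ?f x j)"
    by (intro prod.cong) auto
  ultimately show ?thesis by (simp only: split mult_1)
qed

text \<open>Balance already holds for each node and channel separately, since an activation and the
  matching deactivation reverse each other.\<close>

lemma state_weight_detailed_balance:
  assumes "\<And>i c. i \<in> {1..N} \<Longrightarrow> c \<in> {1..C} \<Longrightarrow> \<mu> i c > 0"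
  shows "state_weight N C \<nu> \<mu> x * transition_rate N C \<nu> \<mu> x y =
    state_weight N C \<nu> \<mu> y * transition_rate N C \<nu> \<mu> y x"
proof -
  let ?w = "state_weight N C \<nu> \<mu>"
  let ?up = "\<lambda>i c x y. if x i = 0 \<and> y = x(i := x i + c) then \<nu> i c else 0"
  let ?down = "\<lambda>i c x y. if x i = c \<and> y = x(i := x i - c) then \<mu> i c else 0"
  have up_down: "?w x * ?up i c x y = ?w y * ?down i c y x"
    if ic: "i \<in> {1..N}" "c \<in> {1..C}" for i c x y
  proof (cases "x i = 0 \<and> y = x(i := c)")
    case True
    then have "y i = c" "x = y(i := y i - c)" by auto
    with True show ?thesis
      using assms[OF ic] state_weight_activate[OF ic, of x \<nu> \<mu>] by simp
  next
    case False
    then have no_up: "\<not> (x i = 0 \<and> y = x(i := x i + c))" by auto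
    \<comment> \<open>Here \<open>x i = c - c = 0\<close>, and writing \<open>c\<close> back at
      \<open>i\<close> recovers \<open>y\<close>. So the reverse transition is possible only if the
      activation is.\<close>
    have "x i = 0 \<and> y = x(i := c)" if "y i = c" "x = y(i := y i - c)"
      using that by auto
    with False have no_down: "\<not> (y i = c \<and> x = y(i := y i - c))" by blast
    show ?thesis by (simp only: no_up no_down if_False mult_zero_right)
  qed
  have "?w x * (?up i c x y + ?down i c x y) = ?w y * (?up i c y x + ?down i c y x)"
    if "i \<in> {1..N}" "c \<in> {1..C}" for i c
    \<comment> \<open>The swapped instance pairs the deactivation from \<open>x\<close> to
      \<open>y\<close> with the activation from \<open>y\<close> to \<open>x\<close>.\<close>
    using up_down[OF that, of x y] up_down[OF that, of y x] by (simp only: distrib_left)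
  then show ?thesis
    unfolding transition_rate_def sum_distrib_left by (intro sum.cong refl)
qed

theorem proposition3p2:
  fixes N C :: nat
    and E :: "nat \<Rightarrow> (nat \<times> nat) set"
    and \<nu> \<mu> :: "nat \<Rightarrow> nat \<Rightarrow> real"
  assumes "C \<ge> 1"
    and "\<And>c. c \<in> {1..C} \<Longrightarrow> simple_graph {1..N} (E c)"
    and "\<And>i c. i \<in> {1..N} \<Longrightarrow> c \<in> {1..C} \<Longrightarrow> \<nu> i c > 0"
    and "\<And>i c. i \<in> {1..N} \<Longrightarrow> c \<in> {1..C} \<Longrightarrow> \<mu> i c > 0"
  shows "stationary_distribution (feasible_states N C E) (transition_rate N C \<nu> \<mu>)
           (product_form N C E \<nu> \<mu>) \<and>
         (\<forall>(M :: 'w measure) X.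
            markov_process M (feasible_states N C E) (transition_rate N C \<nu> \<mu>) X \<and>
            (\<forall>x\<in>feasible_states N C E.
               measure M {\<omega> \<in> space M. X 0 \<omega> = x} = product_form N C E \<nu> \<mu> x) \<longrightarrow>
            (\<forall>t\<ge>0. \<forall>x\<in>feasible_states N C E.
               measure M {\<omega> \<in> space M. X t \<omega> = x} = product_form N C E \<nu> \<mu> x))"
proof -
  let ?S = "feasible_states N C E" and ?q = "transition_rate N C \<nu> \<mu>"
    and ?p = "product_form N C E \<nu> \<mu>"
  have pos: "state_weight N C \<nu> \<mu> x > 0" for x
    using assms(3,4) by (rule state_weight_pos)
  have Z: "normalizing_constant N C E \<nu> \<mu> > 0"
    unfolding normalizing_constant_def
  proof (rule sum_pos)
    show "feasible_states N C E \<noteq> {}" using idle_feasible[of C N E] assms(2) by blast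
  qed (use finite_feasible_states pos in auto)
  have stat: "stationary_distribution ?S ?q ?p"
  proof (rule stationary_distributionI)
    show "0 \<le> ?p x" for x
      using pos[of x] Z by (simp add: product_form_def)
    show "(\<Sum>x\<in>?S. ?p x) = 1"
      using Z by (simp add: product_form_def sum_distrib_left[symmetric]
          normalizing_constant_def[symmetric])
    show "(\<Sum>x\<in>?S. ?p x * generator ?S ?q x y) = 0" if "y \<in> ?S" for y
      using finite_feasible_states that
    proof (rule detailed_balance_generator)
      \<comment> \<open>Both sides carry the same factor, the inverse of the normalizing constant,
        so balance of the weights is enough.\<close>
      show "?p x * ?q x y = ?p y * ?q y x" for x y
        using state_weight_detailed_balance[of N C \<mu> \<nu> x y] assms(4)
        by (simp add: product_form_def mult.assoc)
    qed
  qed (rule finite_feasible_states)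
  moreover have "measure M {\<omega> \<in> space M. X t \<omega> = y} = ?p y"
    if "markov_process M ?S ?q X" "0 \<le> t" "y \<in> ?S"
      and "\<forall>x\<in>?S. measure M {\<omega> \<in> space M. X 0 \<omega> = x} = ?p x"
    for M :: "'w measure" and X t y
    using markov_process_transition[OF that(1) finite_feasible_states that(2,3)] stat that(2-4)
    by (simp add: stationary_distribution_def)
  ultimately show ?thesis by blast
qed

end
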